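(* Let $k \leq n$ be positive integers and let $\lambda = (\lambda_1 \geq \cdots \geq \lambda_s\ge0)$ be a partition of $k$ into $s$ nonnegative parts. If $f \in V_{n,\lambda}$ is any nonzero polynomial whose lexicographically largest monomial is $x_1^{c_1}x_2^{c_2}\cdots x_n^{c_n}$, then $(c_1,\dots,c_n)\in\mathcal{C}_{n,\lambda}$.
   Context: Lexicographic order: $x^{a}<x^{b}$ iff there is $i$ with $a_1=b_1,\dots,a_{i-1}=b_{i-1}$ and $a_i<b_i$. $\lambda'=(\lambda'_1,\dots,\lambda'_n)$ is the conjugate of $\lambda$ padded with zeros ($\lambda'_j=\#\{i:\lambda_i\ge j\}$). $e_d(S)$ is the degree $d$ elementary symmetric polynomial in $\{x_i:i\in S\}$ (zero if $d>|S|$). $I_{n,\lambda}\subseteq\mathbb{Q}[x_1,\dots,x_n]$ is generated by $x_1^s,\dots,x_n^s$ and all $e_d(S)$ with $S\subseteq[n]$, $d>|S|-\lambda'_n-\cdots-\lambda'_{n-|S|+1}$. With $f\odot g=f(\partial/\partial x_1,\dots,\partial/\partial x_n)(g)$ and $\langle f,g\rangle$ the constant term of $f\odot g$, $V_{n,\lambda}=\{g:\langle f,g\rangle=0\ \forall f\in I_{n,\lambda}\}$. $\mathcal{C}_{n,\lambda}$ is the set of length-$n$ sequences of nonnegative integers that are componentwise $\le$ some shuffle (order-preserving interleaving) of the sequences $(\lambda'_j-1,\dots,1,0)$ for $j=1,\dots,k$ (empty when $\lambda'_j=0$) and the constant sequence $(s-1,\dots,s-1)$ of length $n-k$. *)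

theory Defs
  imports HOL.Rat "HOL-Library.Poly_Mapping" "HOL-Algebra.Ideal"
begin

text \<open>
  A monomial is a finitely supported exponent map from variable indices to \<^typ>\<open>nat\<close>.  The
  order \<^const>\<open>less\<close> that Poly_Mapping puts on exponent maps compares them at the smallest index
  where they differ, so on monomials in $x_1,\dots,x_n$ it is the lexicographic order with $x_1$
  the most significant variable.
\<close>

type_synonym monomial = "nat \<Rightarrow>\<^sub>0 nat"
type_synonym rat_mpoly = "monomial \<Rightarrow>\<^sub>0 rat"

definition polys :: "nat \<Rightarrow> rat_mpoly set" where
  "polys n = {p. \<forall>m \<in> Poly_Mapping.keys p. Poly_Mapping.keys m \<subseteq> {1..n}}"

definition poly_ring :: "nat \<Rightarrow> rat_mpoly ring" where
  "poly_ring n = \<lparr>carrier = polys n, mult = (*), one = 1, zero = 0, add = (+)\<rparr>"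

definition var :: "nat \<Rightarrow> rat_mpoly" where
  "var i = Poly_Mapping.single (Poly_Mapping.single i 1) 1"

definition elem_sym :: "nat \<Rightarrow> nat set \<Rightarrow> rat_mpoly" where
  "elem_sym d S = (\<Sum>T | T \<subseteq> S \<and> card T = d. \<Prod>i\<in>T. var i)"

text \<open>
  A partition of \<open>k\<close> into \<open>s\<close> nonnegative parts is a weakly decreasing list; trailing zeros are
  significant, since \<open>s\<close> is the length of the list.
\<close>

definition partition_of :: "nat list \<Rightarrow> nat \<Rightarrow> nat \<Rightarrow> bool" where
  "partition_of lam k s \<longleftrightarrow> sorted_wrt (\<ge>) lam \<and> sum_list lam = k \<and> length lam = s"

text \<open>The argument \<open>j\<close> of the conjugate is meant to be at least 1.\<close>

definition conj_part :: "nat list \<Rightarrow> nat \<Rightarrow> nat" where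
  "conj_part lam j = card {i. i < length lam \<and> lam ! i \<ge> j}"

definition I_gens :: "nat \<Rightarrow> nat list \<Rightarrow> rat_mpoly set" where
  "I_gens n lam =
     {var i ^ length lam | i. i \<in> {1..n}} \<union>
     {elem_sym d S | d S. S \<subseteq> {1..n} \<and>
        int d > int (card S) - (\<Sum>j = n - card S + 1..n. int (conj_part lam j))}"

definition I_ideal :: "nat \<Rightarrow> nat list \<Rightarrow> rat_mpoly set" where
  "I_ideal n lam = Idl\<^bsub>poly_ring n\<^esub> (I_gens n lam)"

definition partial :: "nat \<Rightarrow> rat_mpoly \<Rightarrow> rat_mpoly" where
  "partial i g =
     (\<Sum>m\<in>Poly_Mapping.keys g. Poly_Mapping.single (m - Poly_Mapping.single i 1)
                    (of_nat (Poly_Mapping.lookup m i) * Poly_Mapping.lookup g m))"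

text \<open>The partial derivatives commute, so the order of the factors is immaterial.\<close>

definition partial_monom :: "monomial \<Rightarrow> rat_mpoly \<Rightarrow> rat_mpoly" where
  "partial_monom m =
     fold (\<lambda>i. partial i ^^ Poly_Mapping.lookup m i)
       (sorted_list_of_set (Poly_Mapping.keys m))"

text \<open>$f(\partial/\partial x_1,\dots,\partial/\partial x_n)(g)$\<close>

definition diff_act :: "rat_mpoly \<Rightarrow> rat_mpoly \<Rightarrow> rat_mpoly" where
  "diff_act f g =
     (\<Sum>m\<in>Poly_Mapping.keys f.
        Poly_Mapping.single 0 (Poly_Mapping.lookup f m) * partial_monom m g)"

definition pairing :: "rat_mpoly \<Rightarrow> rat_mpoly \<Rightarrow> rat" where
  "pairing f g = Poly_Mapping.lookup (diff_act f g) 0"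

definition V_space :: "nat \<Rightarrow> nat list \<Rightarrow> rat_mpoly set" where
  "V_space n lam = {g \<in> polys n. \<forall>f \<in> I_ideal n lam. pairing f g = 0}"

fun multi_shuffles :: "'a list list \<Rightarrow> 'a list set" where
  "multi_shuffles [] = {[]}"
| "multi_shuffles (xs # xss) = (\<Union>zs \<in> multi_shuffles xss. shuffles xs zs)"

text \<open>Here \<open>k\<close> is \<^term>\<open>sum_list lam\<close> and \<open>s\<close> is \<^term>\<open>length lam\<close>.\<close>

definition C_seqs :: "nat \<Rightarrow> nat list \<Rightarrow> nat list set" where
  "C_seqs n lam =
     {c. length c = n \<and>
         (\<exists>z \<in> multi_shuffles
                 (map (\<lambda>j. rev [0..<conj_part lam j]) [1..<sum_list lam + 1] @
                  [replicate (n - sum_list lam) (length lam - 1)]).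
            list_all2 (\<le>) c z)}"

definition leading_monom :: "rat_mpoly \<Rightarrow> monomial" where
  "leading_monom f = Max (Poly_Mapping.keys f)"

text \<open>
  \<^const>\<open>genideal\<close> is an intersection over all ideals of a structure, so it is meaningful
  only because the structure is a ring.
\<close>

lemma polys_mult:
  assumes "p \<in> polys n" "q \<in> polys n"
  shows "p * q \<in> polys n"
proof -
  have "Poly_Mapping.keys m \<subseteq> {1..n}" if m: "m \<in> Poly_Mapping.keys (p * q)" for m
  proof -
    obtain a b where ab: "m = a + b" "a \<in> Poly_Mapping.keys p" "b \<in> Poly_Mapping.keys q"
      using m keys_mult[of p q] by blast
    have "Poly_Mapping.keys (a + b) \<subseteq> Poly_Mapping.keys a \<union> Poly_Mapping.keys b"
      by (rule Poly_Mapping.keys_add)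
    moreover have "Poly_Mapping.keys a \<subseteq> {1..n}" "Poly_Mapping.keys b \<subseteq> {1..n}"
      using ab assms unfolding polys_def by blast+
    ultimately show ?thesis unfolding ab by blast
  qed
  then show ?thesis unfolding polys_def by blast
qed

lemma poly_ring_cring: "cring (poly_ring n)"
proof (rule cringI)
  have add: "p + q \<in> polys n" if "p \<in> polys n" "q \<in> polys n" for p q
    using that Poly_Mapping.keys_add[of p q] unfolding polys_def by blast
  have uminus: "- p \<in> polys n" if "p \<in> polys n" for p
    using that by (simp add: polys_def in_keys_iff)
  have zero: "0 \<in> polys n" and one: "1 \<in> polys n"
    by (auto simp: polys_def)
  show "abelian_group (poly_ring n)"
  proof (rule abelian_groupI)
    fix x assume "x \<in> carrier (poly_ring n)"
    then show "\<exists>y\<in>carrier (poly_ring n). y \<oplus>\<^bsub>poly_ring n\<^esub> x = \<zero>\<^bsub>poly_ring n\<^esub>"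
      by (intro bexI[of _ "- x"]) (simp_all add: poly_ring_def uminus)
  qed (auto simp: poly_ring_def add zero algebra_simps)
  show "comm_monoid (poly_ring n)"
    by (rule comm_monoidI) (auto simp: poly_ring_def polys_mult one algebra_simps)
qed (auto simp: poly_ring_def algebra_simps)

end

theory Submission
  imports Defs
begin

text \<open>
  A polynomial $f$ is encoded by the functional $F$ sending $x^m$ to $m!\,f_m$, so that
  $f \in V_{n,\lambda}$ says that the generators of $I_{n,\lambda}$ annihilate $F$ under
  $(p \cdot F)(q) = F(qp)$.  If $x_1^i$ is the power of $x_1$ in the leading monomial, then the
  leading coefficient of $f$ with respect to $x_1$ corresponds, up to scalars, to
  $G = x_1^i \cdot F$, and $p$ annihilates $G$ as soon as $x_1^i p$ annihilates $F$.

  Let $J$ be the largest column with $\lambda'_J > i$, and $\mu$ the partition obtained by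
  shortening that column by one ($\mu = \lambda$ if there is none).  The generators of
  $I_{n-1,\mu}$ in $x_2,\dots,x_n$ annihilate $G$: for $e_d(S)$ with $J \ge n - |S|$, because
  $e_d(S) \equiv e_d(S \cup \{1\})$ modulo $x_1$, which kills $G$; for $J < n - |S|$, because
  $e_{r+1}(S \cup \{1\}) = e_{r+1}(S) + x_1 e_r(S)$ gives
  $x_1^i e_d(S) \equiv (-1)^i e_{d+i}(S)$ modulo $e_r(S \cup \{1\})$ with $r > d$, and
  $i \ge \lambda'_{n-|S|}$.  Induction on $n$ bounds the remaining exponents by a shuffle for
  $\mu$, and the first letter of column $J$ (or of the constant sequence) bounds $i$.
\<close>

section \<open>Functionals on polynomials and their annihilators\<close>

definition functional :: "(monomial \<Rightarrow> rat) \<Rightarrow> rat_mpoly \<Rightarrow> rat" where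
  "functional F p = (\<Sum>m\<in>Poly_Mapping.keys p. Poly_Mapping.lookup p m * F m)"

text \<open>The largest ideal on which \<open>functional F\<close> vanishes. It lives in the ring in
  all variables, so that dropping a variable in the induction leaves the ring unchanged.\<close>

definition annihilator :: "(monomial \<Rightarrow> rat) \<Rightarrow> rat_mpoly set" where
  "annihilator F = {p. \<forall>q. functional F (q * p) = 0}"

lemma functional_superset:
  assumes "finite A" "Poly_Mapping.keys p \<subseteq> A"
  shows "functional F p = (\<Sum>m\<in>A. Poly_Mapping.lookup p m * F m)"
  unfolding functional_def using assms
  by (intro sum.mono_neutral_left) (auto simp: in_keys_iff)

lemma functional_zero [simp]: "functional F 0 = 0"
  by (simp add: functional_def)

lemma functional_add: "functional F (p + q) = functional F p + functional F q"
proof -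
  let ?A = "Poly_Mapping.keys p \<union> Poly_Mapping.keys q"
  have "functional F (p + q) = (\<Sum>m\<in>?A. Poly_Mapping.lookup (p + q) m * F m)"
    using Poly_Mapping.keys_add[of p q] by (intro functional_superset) auto
  then show ?thesis
    by (simp add: functional_superset[of ?A] lookup_add algebra_simps sum.distrib)
qed

lemma functional_uminus: "functional F (- p) = - functional F p"
  using functional_add[of F p "- p"] by simp

lemma functional_sum: "functional F (\<Sum>i\<in>A. p i) = (\<Sum>i\<in>A. functional F (p i))"
  by (induction A rule: infinite_finite_induct) (auto simp: functional_add)

lemma functional_single: "functional F (Poly_Mapping.single m c) = c * F m"
  by (simp add: functional_superset[of "{m}"])

lemma functional_vanish:
  assumes "\<And>m. m \<in> Poly_Mapping.keys p \<Longrightarrow> F m = 0"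
  shows "functional F p = 0"
  using assms by (simp add: functional_def)

lemma sum_singles:
  fixes p :: "'a \<Rightarrow>\<^sub>0 'b::comm_monoid_add"
  shows "(\<Sum>m\<in>Poly_Mapping.keys p. Poly_Mapping.single m (Poly_Mapping.lookup p m)) = p"
proof (rule poly_mapping_eqI)
  fix k
  show "Poly_Mapping.lookup (\<Sum>m\<in>Poly_Mapping.keys p. Poly_Mapping.single m (Poly_Mapping.lookup p m)) k
    = Poly_Mapping.lookup p k"
    by (cases "k \<in> Poly_Mapping.keys p")
      (auto simp: lookup_sum lookup_single when_def in_keys_iff)
qed

text \<open>Translating the argument of \<open>F\<close> is the transpose of multiplication by a
  monomial.\<close>

lemma functional_shift:
  "functional (\<lambda>m. F (m + e)) p = functional F (Poly_Mapping.single e 1 * p)"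
proof -
  have "Poly_Mapping.single e 1 * p
      = (\<Sum>m\<in>Poly_Mapping.keys p. Poly_Mapping.single (e + m) (Poly_Mapping.lookup p m))"
    by (subst (1) sum_singles[of p, symmetric]) (simp add: sum_distrib_left mult_single)
  then have "functional F (Poly_Mapping.single e 1 * p)
      = (\<Sum>m\<in>Poly_Mapping.keys p. Poly_Mapping.lookup p m * F (e + m))"
    by (simp only: functional_sum functional_single)
  then show ?thesis
    by (simp add: functional_def add.commute)
qed

lemma annihilator_add: "p \<in> annihilator F \<Longrightarrow> q \<in> annihilator F \<Longrightarrow> p + q \<in> annihilator F"
  by (simp add: annihilator_def distrib_left functional_add)

lemma annihilator_uminus: "p \<in> annihilator F \<Longrightarrow> - p \<in> annihilator F"
  by (simp add: annihilator_def functional_uminus)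

lemma annihilator_diff: "p \<in> annihilator F \<Longrightarrow> q \<in> annihilator F \<Longrightarrow> p - q \<in> annihilator F"
  using annihilator_add[of p F "- q"] annihilator_uminus by simp

lemma annihilator_mult: "p \<in> annihilator F \<Longrightarrow> q * p \<in> annihilator F"
  by (simp add: annihilator_def mult.assoc[symmetric])

lemma var_power: "var i ^ r = Poly_Mapping.single (Poly_Mapping.single i r) 1"
  by (induction r) (simp_all add: var_def mult_single single_add[symmetric])

lemma annihilator_shift:
  assumes "var a ^ r * p \<in> annihilator F"
  shows "p \<in> annihilator (\<lambda>m. F (m + Poly_Mapping.single a r))"
proof -
  have "functional (\<lambda>m. F (m + Poly_Mapping.single a r)) (q * p)
      = functional F (q * (var a ^ r * p))" for q
    by (simp add: functional_shift var_power mult_ac)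
  then show ?thesis
    using assms by (simp add: annihilator_def)
qed

lemma single_lookup_minus:
  fixes m :: monomial
  assumes "r \<le> Poly_Mapping.lookup m a"
  shows "m - Poly_Mapping.single a r + Poly_Mapping.single a r = m"
  using assms by (intro poly_mapping_eqI) (auto simp: lookup_add lookup_minus lookup_single when_def)

text \<open>If $x^m$ were a multiple of $x_a^r$, then testing $x_a^r$ against the cofactor would
  give \<open>F m = 0\<close>.\<close>

lemma lookup_less_of_annihilator:
  assumes "var a ^ r \<in> annihilator F" "F m \<noteq> 0"
  shows "Poly_Mapping.lookup m a < r"
proof (rule ccontr)
  assume "\<not> ?thesis"
  then have *: "m - Poly_Mapping.single a r + Poly_Mapping.single a r = m"
    by (intro single_lookup_minus) simp
  have "functional F (Poly_Mapping.single (m - Poly_Mapping.single a r) 1 * var a ^ r) = 0"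
    using assms(1) by (simp add: annihilator_def)
  then show False
    using assms(2) by (simp add: var_power mult_single functional_single *)
qed

lemma var_power_in_annihilator:
  assumes "\<And>m. F m \<noteq> 0 \<Longrightarrow> Poly_Mapping.lookup m a < r"
  shows "var a ^ r \<in> annihilator F"
  unfolding annihilator_def
proof (intro CollectI allI functional_vanish)
  fix q m assume "m \<in> Poly_Mapping.keys (q * var a ^ r)"
  then obtain u where "m = u + Poly_Mapping.single a r"
    using keys_mult[of q "var a ^ r"] by (auto simp: var_power)
  then have "r \<le> Poly_Mapping.lookup m a"
    by (simp add: lookup_add)
  then show "F m = 0"
    using assms[of m] by force
qed

section \<open>Elementary symmetric polynomials\<close>

lemma elem_sym_zero: "finite S \<Longrightarrow> elem_sym 0 S = 1"
proof -
  assume "finite S"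
  then have "{T. T \<subseteq> S \<and> card T = 0} = {{}}"
    by (auto dest: finite_subset)
  then show ?thesis
    by (simp add: elem_sym_def)
qed

text \<open>The subsets of size \<open>Suc d\<close> are sorted by whether they contain
  \<open>a\<close>.\<close>

lemma elem_sym_Suc_insert:
  assumes "finite S" "a \<notin> S"
  shows "elem_sym (Suc d) (insert a S) = elem_sym (Suc d) S + var a * elem_sym d S"
proof -
  let ?A = "{T. T \<subseteq> S \<and> card T = Suc d}" and ?B = "{T. T \<subseteq> S \<and> card T = d}"
  let ?C = "{T. T \<subseteq> insert a S \<and> card T = Suc d}"
  have fin: "finite T" if "T \<subseteq> S" for T
    using that assms finite_subset by blast
  have "T \<in> ?A \<union> insert a ` ?B" if T: "T \<in> ?C" for T
  proof (cases "a \<in> T")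
    case True
    have "T - {a} \<in> ?B"
      using T True assms by (auto simp: card_Diff_singleton)
    moreover have "T = insert a (T - {a})"
      using True by blast
    ultimately show ?thesis
      by blast
  qed (use T in auto)
  moreover have "insert a T \<in> ?C" if "T \<in> ?B" for T
    using that assms fin[of T] by (auto simp: card_insert_if)
  ultimately have C: "?C = ?A \<union> insert a ` ?B"
    by blast
  have prod: "(\<Prod>i\<in>insert a T. var i) = var a * (\<Prod>i\<in>T. var i)" if "T \<in> ?B" for T
    using that assms fin[of T] by (subst prod.insert) auto
  have inj: "inj_on (insert a) ?B"
    using assms(2) by (intro inj_onI) (metis (mono_tags, lifting) insert_ident mem_Collect_eq subsetD)
  have "elem_sym (Suc d) (insert a S)
      = (\<Sum>T\<in>?A. \<Prod>i\<in>T. var i) + (\<Sum>T\<in>insert a ` ?B. \<Prod>i\<in>T. var i)"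
    unfolding elem_sym_def C using assms by (intro sum.union_disjoint) auto
  also have "(\<Sum>T\<in>insert a ` ?B. \<Prod>i\<in>T. var i) = (\<Sum>T\<in>?B. var a * (\<Prod>i\<in>T. var i))"
    using prod by (subst sum.reindex[OF inj]) (auto intro!: sum.cong)
  finally show ?thesis
    by (simp add: elem_sym_def sum_distrib_left)
qed

text \<open>Each factor $x_a$ is traded for one more degree by the recurrence
  \<open>elem_sym_Suc_insert\<close>, so the induction on \<open>i\<close> has to vary
  \<open>d\<close>.\<close>

lemma power_times_elem_sym_in_annihilator:
  assumes "finite S" "a \<notin> S"
    and "\<And>r. d < r \<Longrightarrow> elem_sym r (insert a S) \<in> annihilator F"
    and "elem_sym (d + i) S \<in> annihilator F"
  shows "var a ^ i * elem_sym d S \<in> annihilator F"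
  using assms(3,4)
proof (induction i arbitrary: d)
  case (Suc i)
  have "var a ^ i * elem_sym (Suc d) S \<in> annihilator F"
    using Suc.prems by (intro Suc.IH) auto
  moreover have "var a ^ i * elem_sym (Suc d) (insert a S) \<in> annihilator F"
    using Suc.prems by (intro annihilator_mult) auto
  ultimately have "var a ^ i * elem_sym (Suc d) (insert a S) - var a ^ i * elem_sym (Suc d) S
      \<in> annihilator F"
    by (intro annihilator_diff)
  then show ?case
    using elem_sym_Suc_insert[OF assms(1,2), of d] by (simp add: algebra_simps)
qed simp

section \<open>Peeling off the first letter of a shuffle\<close>

text \<open>A shuffle may start with the first letter of any of its words; the induction moves that
  letter past the words before position \<open>p\<close>.\<close>

lemma multi_shuffles_Cons:
  assumes "p < length xss" "xss ! p = y # ys" "zs \<in> multi_shuffles (xss[p := ys])"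
  shows "y # zs \<in> multi_shuffles xss"
  using assms
proof (induction xss arbitrary: p zs)
  case (Cons xs xss)
  show ?case
  proof (cases p)
    case 0
    then show ?thesis
      using Cons.prems by (auto intro: Cons_in_shuffles_leftI)
  next
    case (Suc q)
    then obtain ws where ws: "ws \<in> multi_shuffles (xss[q := ys])" "zs \<in> shuffles xs ws"
      using Cons.prems by auto
    have "y # ws \<in> multi_shuffles xss"
      using Suc Cons.prems ws by (intro Cons.IH[of q]) auto
    then show ?thesis
      using ws(2) by (auto intro: Cons_in_shuffles_rightI)
  qed
qed simp

lemma multi_shuffles_Nils:
  assumes "\<And>xs. xs \<in> set xss \<Longrightarrow> xs = []"
  shows "multi_shuffles xss = {[]}"
  using assms by (induction xss) auto

section \<open>The pairing as a functional\<close>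

text \<open>This is $m!$, the pairing of $x^m$ with itself; distinct monomials are
  orthogonal.\<close>

definition weight :: "monomial \<Rightarrow> rat" where
  "weight m = (\<Prod>i\<in>Poly_Mapping.keys m. fact (Poly_Mapping.lookup m i))"

lemma weight_nonzero: "weight m \<noteq> 0"
  by (simp add: weight_def)

lemma lookup_partial:
  "Poly_Mapping.lookup (partial i g) u
    = of_nat (Suc (Poly_Mapping.lookup u i)) * Poly_Mapping.lookup g (u + Poly_Mapping.single i 1)"
proof -
  let ?e = "Poly_Mapping.single i (1::nat)"
  let ?t = "\<lambda>m. of_nat (Poly_Mapping.lookup m i) * Poly_Mapping.lookup g m"
  \<comment> \<open>Exponent subtraction is truncated: for $m_i = 0$ it leaves \<open>m\<close>
    unchanged, but then the coefficient is zero.\<close>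
  have eq: "(?t m when m - ?e = u) = (if m = u + ?e then ?t m else 0)" for m
  proof (cases "Poly_Mapping.lookup m i = 0")
    case True
    then show ?thesis by (auto simp: when_def)
  next
    case False
    then have "m - ?e + ?e = m"
      by (intro single_lookup_minus) simp
    then have "m - ?e = u \<longleftrightarrow> m = u + ?e"
      by (metis add_diff_cancel_right')
    then show ?thesis by (simp add: when_def)
  qed
  have "Poly_Mapping.lookup (partial i g) u
      = (\<Sum>m\<in>Poly_Mapping.keys g. if m = u + ?e then ?t m else 0)"
    unfolding partial_def lookup_sum lookup_single eq ..
  also have "\<dots> = ?t (u + ?e)"
    by (auto simp: in_keys_iff)
  finally show ?thesis
    by (simp add: lookup_add)
qed

text \<open>The factor is $(t+r)!/t!$, with the denominator cleared.\<close>

lemma lookup_partial_power: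
  assumes "Poly_Mapping.lookup u i = t"
  shows "fact t * Poly_Mapping.lookup ((partial i ^^ r) g) u
    = fact (t + r) * Poly_Mapping.lookup g (u + Poly_Mapping.single i r)"
  using assms
proof (induction r arbitrary: u t)
  case (Suc r)
  let ?v = "u + Poly_Mapping.single i 1"
  have "fact t * Poly_Mapping.lookup ((partial i ^^ Suc r) g) u
      = fact (Suc t) * Poly_Mapping.lookup ((partial i ^^ r) g) ?v"
    using Suc.prems by (simp add: lookup_partial algebra_simps)
  also have "\<dots> = fact (Suc t + r) * Poly_Mapping.lookup g (?v + Poly_Mapping.single i r)"
    using Suc.prems by (intro Suc.IH) (simp add: lookup_add)
  finally show ?case
    by (simp add: add.assoc single_add[symmetric])
qed simp

lemma lookup_fold_partial:
  assumes "distinct xs" "\<And>i. i \<in> set xs \<Longrightarrow> Poly_Mapping.lookup u i = 0"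
  shows "Poly_Mapping.lookup (fold (\<lambda>i. partial i ^^ Poly_Mapping.lookup m i) xs g) u
    = (\<Prod>i\<in>set xs. fact (Poly_Mapping.lookup m i))
      * Poly_Mapping.lookup g (u + (\<Sum>i\<in>set xs. Poly_Mapping.single i (Poly_Mapping.lookup m i)))"
  using assms
proof (induction xs arbitrary: g)
  case (Cons x xs)
  let ?r = "Poly_Mapping.lookup m x"
  let ?v = "u + (\<Sum>i\<in>set xs. Poly_Mapping.single i (Poly_Mapping.lookup m i))"
  \<comment> \<open>\<open>fold\<close> differentiates by \<open>x\<close> first, so the induction
    hypothesis reads that derivative at \<open>?v\<close>. By distinctness \<open>?v\<close> has
    exponent 0 at \<open>x\<close>, so the whole factorial appears.\<close>
  have "Poly_Mapping.lookup ?v x = 0"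
    using Cons.prems by (auto simp: lookup_add lookup_sum lookup_single when_def)
  then have "Poly_Mapping.lookup ((partial x ^^ ?r) g) ?v
      = fact ?r * Poly_Mapping.lookup g (?v + Poly_Mapping.single x ?r)"
    using lookup_partial_power[of ?v x 0 ?r g] by simp
  then show ?case
    using Cons by (simp add: algebra_simps)
qed simp

lemma lookup_partial_monom_zero:
  "Poly_Mapping.lookup (partial_monom m g) 0 = weight m * Poly_Mapping.lookup g m"
  unfolding partial_monom_def weight_def
  by (subst lookup_fold_partial) (simp_all add: sum_singles)

lemma lookup_scale:
  "Poly_Mapping.lookup (Poly_Mapping.single 0 c * p) m = c * Poly_Mapping.lookup (p :: rat_mpoly) m"
  by (simp add: mult_map_scale_conv_mult[symmetric] Poly_Mapping.map.rep_eq when_def)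

lemma pairing_eq_functional:
  "pairing p g = functional (\<lambda>m. weight m * Poly_Mapping.lookup g m) p"
  by (simp add: pairing_def diff_act_def lookup_sum lookup_scale lookup_partial_monom_zero
      functional_def)

text \<open>\<open>V_space\<close> tests multiples by polynomials in $x_1,...,x_n$ only, the
  annihilator multiples by all polynomials. By linearity monomial multipliers suffice, and one with
  a foreign variable yields only monomials that do not occur in \<open>f\<close>.\<close>

lemma I_gens_in_annihilator:
  assumes f: "f \<in> V_space n lam" and h: "h \<in> I_gens n lam"
  shows "h \<in> annihilator (\<lambda>m. weight m * Poly_Mapping.lookup f m)" (is "h \<in> annihilator ?F")
proof -
  interpret R: cring "poly_ring n"
    by (rule poly_ring_cring)
  have zero: "0 \<in> polys n" and one: "1 \<in> polys n"
    by (auto simp: polys_def)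
  have add: "p + q \<in> polys n" if "p \<in> polys n" "q \<in> polys n" for p q
    using that Poly_Mapping.keys_add[of p q] unfolding polys_def by blast
  have var: "var i \<in> polys n" if "i \<in> {1..n}" for i
    using that by (auto simp: var_def polys_def)
  have pow: "p ^ r \<in> polys n" if "p \<in> polys n" for p r
    using that by (induction r) (auto simp: one polys_mult)
  have prod: "(\<Prod>i\<in>T. var i) \<in> polys n" if "T \<subseteq> {1..n}" for T
    using that by (induction T rule: infinite_finite_induct) (auto simp: one intro!: polys_mult var)
  have sum: "(\<Sum>i\<in>T. p i) \<in> polys n" if "\<And>i. i \<in> T \<Longrightarrow> p i \<in> polys n" for T and p :: "nat set \<Rightarrow> _"
    using that by (induction T rule: infinite_finite_induct) (auto simp: zero add)
  have "elem_sym d S \<in> polys n" if "S \<subseteq> {1..n}" for d S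
    unfolding elem_sym_def using that by (intro sum prod) auto
  then have gens: "I_gens n lam \<subseteq> carrier (poly_ring n)"
    unfolding I_gens_def by (auto simp: poly_ring_def intro!: pow var)
  have I: "ideal (I_ideal n lam) (poly_ring n)"
    unfolding I_ideal_def by (rule R.genideal_ideal[OF gens])
  have "h \<in> I_ideal n lam"
    unfolding I_ideal_def using R.genideal_self[OF gens] h by blast
  then have mult: "q * h \<in> I_ideal n lam" if "q \<in> polys n" for q
    using ideal.I_l_closed[OF I, of h q] that by (simp add: poly_ring_def)
  have "functional ?F (Poly_Mapping.single u c * h) = 0" for u c
  proof (cases "Poly_Mapping.keys u \<subseteq> {1..n}")
    case True
    then have "Poly_Mapping.single u c \<in> polys n"
      by (simp add: polys_def)
    from mult[OF this] f show ?thesis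
      by (simp add: V_space_def pairing_eq_functional)
  next
    case False
    show ?thesis
    proof (rule functional_vanish)
      fix m assume "m \<in> Poly_Mapping.keys (Poly_Mapping.single u c * h)"
      then obtain v where "m = u + v"
        using keys_mult[of "Poly_Mapping.single u c" h] by (fastforce split: if_splits)
      then have "\<not> Poly_Mapping.keys m \<subseteq> {1..n}"
        using False by (auto simp: in_keys_iff lookup_add subset_iff)
      then have "m \<notin> Poly_Mapping.keys f"
        using f by (auto simp: V_space_def polys_def)
      then show "?F m = 0"
        by (simp add: in_keys_iff)
    qed
  qed
  then have "functional ?F (q * h) = 0" for q
    by (subst sum_singles[of q, symmetric]) (simp add: sum_distrib_right functional_sum)
  then show ?thesis
    by (simp add: annihilator_def)
qed

section \<open>The leading exponents\<close>

text \<open>The indices below \<open>a\<close> carry no exponent in \<open>m\<close>, so a smaller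
  \<open>u\<close> first differs from \<open>m\<close> at \<open>a\<close> or later.\<close>

lemma lookup_le_of_poly_mapping_le:
  fixes u m :: monomial
  assumes "u \<le> m" "\<And>j. j < a \<Longrightarrow> Poly_Mapping.lookup m j = 0"
  shows "Poly_Mapping.lookup u a \<le> Poly_Mapping.lookup m a"
proof (cases "u = m")
  case False
  then have "u < m"
    using assms(1) by simp
  then have "less_fun (Poly_Mapping.lookup u) (Poly_Mapping.lookup m)"
    by (simp add: less_poly_mapping.rep_eq)
  then obtain k where k: "Poly_Mapping.lookup u k < Poly_Mapping.lookup m k"
    "\<And>j. j < k \<Longrightarrow> Poly_Mapping.lookup u j = Poly_Mapping.lookup m j"
    unfolding less_fun_def by blast
  then have "a \<le> k"
    using assms(2)[of k] by force
  then show ?thesis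
    using k by (cases "a = k") auto
qed simp

text \<open>A nonempty column \<open>j\<close> forces columns 1 to \<open>j\<close> to be nonempty,
  each contributing at least one box.\<close>

lemma index_le_sum_of_antimono:
  fixes L :: "nat \<Rightarrow> nat"
  assumes "\<And>i j. 1 \<le> i \<Longrightarrow> i \<le> j \<Longrightarrow> L j \<le> L i" "\<And>j. N < j \<Longrightarrow> L j = 0" "0 < L j"
  shows "j \<le> (\<Sum>i=1..N. L i)"
proof -
  have "j \<le> N"
    using assms(2)[of j] assms(3) by (cases "N < j") auto
  have "1 \<le> L i" if "i \<in> {1..j}" for i
    using assms(1)[of i j] assms(3) that by auto
  then have "(\<Sum>i=1..j. 1) \<le> (\<Sum>i=1..j. L i)"
    by (intro sum_mono) auto
  also have "\<dots> \<le> (\<Sum>i=1..N. L i)"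
    using \<open>j \<le> N\<close> by (intro sum_mono2) auto
  finally show ?thesis
    by simp
qed

text \<open>The form fits the induction: the smallest variable is dropped without renaming the
  others, hence the interval starting at \<open>a\<close>. The partition is carried by its column
  lengths \<open>L\<close>, with \<open>N\<close> fixed and empty columns allowed, so that a
  shortened column keeps its position in the list of words.\<close>

lemma leading_exponents_le_shuffle:
  fixes L :: "nat \<Rightarrow> nat" and F :: "monomial \<Rightarrow> rat"
  assumes "(\<Sum>j=1..N. L j) \<le> n"
    and "\<And>i j. 1 \<le> i \<Longrightarrow> i \<le> j \<Longrightarrow> L j \<le> L i"
    and "\<And>j. N < j \<Longrightarrow> L j = 0"
    and "F m \<noteq> 0" and "\<And>u. F u \<noteq> 0 \<Longrightarrow> u \<le> m"
    and "\<And>u. F u \<noteq> 0 \<Longrightarrow> Poly_Mapping.keys u \<subseteq> {a..<a + n}"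
    and "\<And>i. i \<in> {a..<a + n} \<Longrightarrow> var i ^ s \<in> annihilator F"
    and "\<And>d S. S \<subseteq> {a..<a + n} \<Longrightarrow>
      int d > int (card S) - (\<Sum>j=n - card S + 1..n. int (L j)) \<Longrightarrow> elem_sym d S \<in> annihilator F"
  shows "\<exists>z\<in>multi_shuffles (map (\<lambda>j. rev [0..<L j]) [1..<N + 1] @
      [replicate (n - (\<Sum>j=1..N. L j)) (s - 1)]).
    list_all2 (\<le>) (map (Poly_Mapping.lookup m) [a..<a + n]) z"
  using assms
proof (induction n arbitrary: a L F m)
  case 0
  then have "L j = 0" if "j \<in> {1..N}" for j
    using that by simp
  then have "multi_shuffles (map (\<lambda>j. rev [0..<L j]) [1..<N + 1] @
      [replicate (0 - (\<Sum>j=1..N. L j)) (s - 1)]) = {[]}"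
    by (intro multi_shuffles_Nils) auto
  then show ?case
    by simp
next
  case (Suc n)
  note le = Suc.prems(1) and anti = Suc.prems(2) and zero = Suc.prems(3)
    and top = Suc.prems(4,5) and vars = Suc.prems(6) and pow = Suc.prems(7)
    and esym = Suc.prems(8)
  define i where "i = Poly_Mapping.lookup m a"
  define G where "G = (\<lambda>u. F (u + Poly_Mapping.single a i))"
  define m' where "m' = m - Poly_Mapping.single a i"
  define k where "k = (\<Sum>j=1..N. L j)"
  have m: "m' + Poly_Mapping.single a i = m"
    unfolding m'_def by (rule single_lookup_minus) (simp add: i_def)
  have below: "Poly_Mapping.lookup u a \<le> i" if "F u \<noteq> 0" for u
    unfolding i_def using top(2)[OF that] vars[OF top(1)]
    by (intro lookup_le_of_poly_mapping_le) (auto simp: subset_iff in_keys_iff)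
  have "i < s"
    using lookup_less_of_annihilator[OF pow[of a] top(1)] by (simp add: i_def)
  \<comment> \<open>As \<open>i\<close> is the largest exponent of $x_a$ on the support of
    \<open>F\<close>, $x_a^{i+1}$ annihilates \<open>F\<close>.\<close>
  have var_G: "var a \<in> annihilator G"
    unfolding G_def
    using var_power_in_annihilator[of F a "Suc i"] below
    by (intro annihilator_shift) (auto simp: less_Suc_eq_le mult.commute)
  have G_top: "u \<le> m'" "Poly_Mapping.keys u \<subseteq> {Suc a..<Suc a + n}"
    if "G u \<noteq> 0" for u
  proof -
    show "u \<le> m'"
      using top(2)[of "u + Poly_Mapping.single a i"] that
      by (simp add: G_def m[symmetric])
    have "Poly_Mapping.lookup u a = 0"
      using below[of "u + Poly_Mapping.single a i"] that by (simp add: G_def lookup_add)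
    have "Poly_Mapping.keys (u + Poly_Mapping.single a i) \<subseteq> {a..<a + Suc n}"
      using that by (intro vars) (simp add: G_def)
    then have "Poly_Mapping.keys u \<subseteq> {a..<a + Suc n}"
      by (auto simp: subset_iff in_keys_iff lookup_add)
    then have "Poly_Mapping.keys u \<subseteq> {a..<a + Suc n} - {a}"
      using \<open>Poly_Mapping.lookup u a = 0\<close> by (auto simp: in_keys_iff)
    then show "Poly_Mapping.keys u \<subseteq> {Suc a..<Suc a + n}"
      by auto
  qed
  have "G m' \<noteq> 0"
    using top m by (simp add: G_def)
  have pow_G: "var j ^ s \<in> annihilator G" if "j \<in> {Suc a..<Suc a + n}" for j
    unfolding G_def using pow[of j] that by (intro annihilator_shift annihilator_mult) auto
  have in_G: "p \<in> annihilator G" if "p \<in> annihilator F" for p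
    unfolding G_def using that by (intro annihilator_shift annihilator_mult)
  \<comment> \<open>Both the set and the number of variables grow by one, so the sum still starts at
    column $n-|S|+1$, but now ends at $n+1$.\<close>
  have insert_F: "elem_sym d (insert a S) \<in> annihilator F"
    if "S \<subseteq> {Suc a..<Suc a + n}"
      "int d > int (card S) + 1 - (\<Sum>j=n - card S + 1..Suc n. int (L j))" for d S
  proof -
    have "finite S" "a \<notin> S"
      using that(1) finite_subset by auto
    then show ?thesis
      using that by (intro esym) auto
  qed
  have card_S: "card S \<le> n" if "S \<subseteq> {Suc a..<Suc a + n}" for S
    using card_mono[OF _ that] by simp
  have sum_Suc: "(\<Sum>j=n - c + 1..Suc n. int (L j)) = (\<Sum>j=n - c + 1..n. int (L j)) + int (L (Suc n))" for c
    by auto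
  have sum_head: "(\<Sum>j=n - c + 1..Suc n. int (L j))
      = int (L (n - c + 1)) + (\<Sum>j=Suc n - c + 1..Suc n. int (L j))" if "c \<le> n" for c
    using sum.atLeast_Suc_atMost[of "n - c + 1" "Suc n" "\<lambda>j. int (L j)"] that
    by (simp add: Suc_diff_le del: sum.cl_ivl_Suc)
  \<comment> \<open>The bound on \<open>d\<close> is $|S|$ minus the sum up to column
    \<open>n\<close>. Taking \<open>r > d\<close> gains the 1 needed for \<open>insert a S\<close>.
    The sum for \<open>S\<close> itself lacks column $n-|S|+1$, whose length is at most
    \<open>i\<close>; raising the degree by \<open>i\<close> pays for it.\<close>
  have small: "elem_sym d S \<in> annihilator G"
    if S: "S \<subseteq> {Suc a..<Suc a + n}" and "L (n - card S + 1) \<le> i"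
      and d: "int d > int (card S) - (\<Sum>j=n - card S + 1..Suc n. int (L j)) + int (L (Suc n))" for d S
    unfolding G_def
  proof (intro annihilator_shift power_times_elem_sym_in_annihilator)
    show "finite S" "a \<notin> S"
      using S finite_subset by auto
    show "elem_sym r (insert a S) \<in> annihilator F" if "d < r" for r
      using that d by (intro insert_F[OF S]) linarith
    show "elem_sym (d + i) S \<in> annihilator F"
      using S d that(2) sum_head[OF card_S[OF S]] by (intro esym) auto
  qed
  have Cons: "map (Poly_Mapping.lookup m) [a..<a + Suc n]
      = i # map (Poly_Mapping.lookup m') [Suc a..<Suc a + n]"
    by (simp add: upt_conv_Cons i_def m'_def lookup_minus lookup_single when_def del: upt_Suc)
  let ?xss = "map (\<lambda>j. rev [0..<L j]) [1..<N + 1] @ [replicate (Suc n - k) (s - 1)]"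
  \<comment> \<open>It remains to find a word whose first letter is at least \<open>i\<close> and
    whose removal leaves the words of the induction hypothesis.\<close>
  have step: "\<exists>z\<in>multi_shuffles ?xss.
      list_all2 (\<le>) (map (Poly_Mapping.lookup m) [a..<a + Suc n]) z"
    if "p < length ?xss" "?xss ! p = y # ys" "i \<le> y" "?xss[p := ys] = yss"
      "\<exists>z\<in>multi_shuffles yss. list_all2 (\<le>) (map (Poly_Mapping.lookup m') [Suc a..<Suc a + n]) z"
    for p y ys yss
    using that multi_shuffles_Cons[OF that(1,2)] unfolding Cons by fastforce
  show ?case
  proof (cases "\<exists>j\<in>{1..N}. i < L j")
    case True
    define A where "A = {j \<in> {1..N}. i < L j}"
    define J where "J = Max A"
    define L' where "L' = L(J := L J - 1)"
    have A: "finite A" "A \<noteq> {}"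
      using True by (auto simp: A_def)
    then have J: "1 \<le> J" "J \<le> N" "i < L J"
      using Max_in[of A] by (auto simp: J_def A_def)
    have beyond: "L j \<le> i" if "J < j" for j
    proof (rule ccontr)
      assume *: "\<not> ?thesis"
      then have "j \<in> A"
        using zero[of j] that by (force simp: A_def not_le)
      then show False
        using Max_ge[OF A(1)] that by (force simp: J_def)
    qed
    have "J \<le> Suc n"
      using index_le_sum_of_antimono[of L N J] anti zero J le by force
    have sum_L': "(\<Sum>j\<in>B. L j) = (\<Sum>j\<in>B. L' j) + (if J \<in> B then 1 else 0)" if "finite B" for B
      using that J
      by (cases "J \<in> B") (auto simp: L'_def sum.remove intro!: sum.cong)
    have k: "k = Suc (\<Sum>j=1..N. L' j)"
      using sum_L'[of "{1..N}"] J by (simp add: k_def)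
    have ih: "\<exists>z\<in>multi_shuffles (map (\<lambda>j. rev [0..<L' j]) [1..<N + 1] @
        [replicate (n - (\<Sum>j=1..N. L' j)) (s - 1)]).
      list_all2 (\<le>) (map (Poly_Mapping.lookup m') [Suc a..<Suc a + n]) z"
    proof (rule Suc.IH[of L' G m' "Suc a"])
      show "(\<Sum>j=1..N. L' j) \<le> n"
        using k le by (simp add: k_def)
      show "L' j \<le> L' j'" if "1 \<le> j'" "j' \<le> j" for j j'
      \<comment> \<open>Only a comparison of \<open>J\<close> with a later column could fail, and
        there \<open>L J - 1\<close> is at least \<open>i\<close>, which bounds
        \<open>L j\<close>.\<close>
      proof (cases "j' = J \<and> J < j")
        case True
        then show ?thesis
          using beyond[of j] J by (auto simp: L'_def)
      next
        case False
        then show ?thesis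
          using anti[OF that] that by (auto simp: L'_def)
      qed
      show "L' j = 0" if "N < j" for j
        using zero that J by (auto simp: L'_def)
      show "elem_sym d S \<in> annihilator G"
        if S: "S \<subseteq> {Suc a..<Suc a + n}"
          and d: "int d > int (card S) - (\<Sum>j=n - card S + 1..n. int (L' j))" for d S
      proof (cases "J < n - card S + 1")
        case True
        then have "(\<Sum>j=n - card S + 1..n. int (L' j)) = (\<Sum>j=n - card S + 1..n. int (L j))"
          by (intro sum.cong) (auto simp: L'_def)
        then show ?thesis
          using S d True sum_Suc[of "card S"] by (intro small beyond) auto
      next
        case False
        \<comment> \<open>Column \<open>J\<close> lies in the range, so shortening it lowers the sum
          by one, which offsets the extra element of \<open>insert a S\<close>.\<close>
        have "(\<Sum>j=n - card S + 1..Suc n. L j) = (\<Sum>j=n - card S + 1..Suc n. L' j) + 1"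
          using False \<open>J \<le> Suc n\<close> by (subst sum_L') auto
        then have "(\<Sum>j=n - card S + 1..Suc n. int (L j))
            = (\<Sum>j=n - card S + 1..n. int (L' j)) + int (L' (Suc n)) + 1"
          by (auto simp flip: of_nat_sum)
        then have "int d > int (card S) + 1 - (\<Sum>j=n - card S + 1..Suc n. int (L j))"
          using d by linarith
        then have ins: "elem_sym d (insert a S) \<in> annihilator G"
          by (rule in_G[OF insert_F[OF S]])
        have fin: "finite S" "a \<notin> S"
          using S finite_subset by auto
        show ?thesis
        proof (cases d)
          case 0
          then show ?thesis
            using ins fin by (simp add: elem_sym_zero)
        next
          case (Suc e)
          have "elem_sym e S * var a \<in> annihilator G"
            using var_G by (rule annihilator_mult)
          from annihilator_diff[OF ins this] show ?thesis
            using Suc elem_sym_Suc_insert[OF fin, of e] by (simp add: mult.commute)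
        qed
      qed
      show "G m' \<noteq> 0"
        by fact
      show "u \<le> m'" "Poly_Mapping.keys u \<subseteq> {Suc a..<Suc a + n}" if "G u \<noteq> 0" for u
        using G_top[OF that] by auto
      show "var j ^ s \<in> annihilator G" if "j \<in> {Suc a..<Suc a + n}" for j
        using pow_G[OF that] .
    qed
    \<comment> \<open>Columns are numbered from 1 and positions from 0. One variable and one box
      disappear together, so the constant word keeps its length.\<close>
    have upd: "?xss[J - 1 := rev [0..<L J - 1]] = map (\<lambda>j. rev [0..<L' j]) [1..<N + 1] @
        [replicate (n - (\<Sum>j=1..N. L' j)) (s - 1)]"
      using J k
      by (intro nth_equalityI)
        (auto simp: nth_append nth_list_update L'_def nth_Cons' simp del: upt_Suc)
    have "[0..<L J] = [0..<L J - 1] @ [L J - 1]"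
      using J(3) by (cases "L J") auto
    then have first: "?xss ! (J - 1) = (L J - 1) # rev [0..<L J - 1]"
      using J by (simp add: nth_append del: upt_Suc)
    show ?thesis
      unfolding k_def[symmetric] by (rule step[OF _ first _ upd ih]) (use J in auto)
  next
    case False
    have beyond: "L j \<le> i" if "1 \<le> j" for j
      using False zero[of j] that by (cases "j \<le> N") (auto simp: not_less)
    have "k \<le> n" \<comment> \<open>otherwise $x_a^i$ itself would annihilate $F$\<close>
    proof (rule ccontr)
      assume "\<not> ?thesis"
      then have "k = Suc n"
        using le by (simp add: k_def)
      let ?S = "{Suc a..<Suc a + n}"
      have "L j = 0" if "Suc n < j" for j
        using index_le_sum_of_antimono[of L N j] anti zero that \<open>k = Suc n\<close>
        unfolding k_def by fastforce
      then have "(\<Sum>j=1..Suc n. L j) = (\<Sum>j=1..max N (Suc n). L j)"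
        by (intro sum.mono_neutral_left) auto
      also have "\<dots> = (\<Sum>j=1..N. L j)"
        using zero by (intro sum.mono_neutral_right) auto
      finally have "(\<Sum>j=1..Suc n. L j) = Suc n"
        using \<open>k = Suc n\<close> by (simp add: k_def)
      then have sum: "(\<Sum>j=1..Suc n. int (L j)) = int n + 1"
        by (simp flip: of_nat_sum)
      then have sum2: "(\<Sum>j=2..Suc n. int (L j)) = int n + 1 - int (L 1)"
        using sum_head[of n] by (simp add: numeral_2_eq_2)
      \<comment> \<open>For \<open>insert a ?S\<close> the threshold is $(n+1)-(n+1) = 0$, so every
        positive degree is allowed. For \<open>?S\<close> it is \<open>L 1 - 1\<close> as an
        integer, which is below \<open>i\<close>.\<close>
      have "var a ^ i * elem_sym 0 ?S \<in> annihilator F"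
      proof (rule power_times_elem_sym_in_annihilator)
        show "elem_sym r (insert a ?S) \<in> annihilator F" if "0 < r" for r
          using that sum by (intro insert_F) auto
        show "elem_sym (0 + i) ?S \<in> annihilator F"
          using sum2 beyond[of 1] by (intro esym) (auto simp: numeral_2_eq_2)
      qed auto
      then have "var a ^ i \<in> annihilator F"
        by (simp add: elem_sym_zero)
      then show False
        using lookup_less_of_annihilator[of a i F m] top(1) by (simp add: i_def)
    qed
    have ih: "\<exists>z\<in>multi_shuffles (map (\<lambda>j. rev [0..<L j]) [1..<N + 1] @
        [replicate (n - (\<Sum>j=1..N. L j)) (s - 1)]).
      list_all2 (\<le>) (map (Poly_Mapping.lookup m') [Suc a..<Suc a + n]) z"
    proof (rule Suc.IH[of L G m' "Suc a"])
      show "(\<Sum>j=1..N. L j) \<le> n"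
        using \<open>k \<le> n\<close> by (simp add: k_def)
      \<comment> \<open>No column exceeds \<open>i\<close>, so \<open>small\<close> covers every
        \<open>S\<close>.\<close>
      show "elem_sym d S \<in> annihilator G"
        if "S \<subseteq> {Suc a..<Suc a + n}"
          "int d > int (card S) - (\<Sum>j=n - card S + 1..n. int (L j))" for d S
        using that sum_Suc[of "card S"] by (intro small beyond) auto
      show "G m' \<noteq> 0"
        by fact
      show "u \<le> m'" "Poly_Mapping.keys u \<subseteq> {Suc a..<Suc a + n}" if "G u \<noteq> 0" for u
        using G_top[OF that] by auto
      show "var j ^ s \<in> annihilator G" if "j \<in> {Suc a..<Suc a + n}" for j
        using pow_G[OF that] .
    qed (fact anti zero)+
    \<comment> \<open>Position \<open>N\<close> holds the constant word, nonempty because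
      \<open>k \<le> n\<close>; its letter bounds \<open>i\<close> because
      \<open>i < s\<close>.\<close>
    have first: "?xss ! N = (s - 1) # replicate (n - k) (s - 1)"
      using \<open>k \<le> n\<close> by (simp add: nth_append Suc_diff_le del: upt_Suc)
    have upd: "?xss[N := replicate (n - k) (s - 1)] = map (\<lambda>j. rev [0..<L j]) [1..<N + 1] @
        [replicate (n - (\<Sum>j=1..N. L j)) (s - 1)]"
      by (simp add: list_update_append k_def del: upt_Suc)
    show ?thesis
      unfolding k_def[symmetric] by (rule step[OF _ first _ upd ih]) (use \<open>i < s\<close> in auto)
  qed
qed

lemma conj_part_antimono: "i \<le> j \<Longrightarrow> conj_part lam j \<le> conj_part lam i"
  unfolding conj_part_def by (intro card_mono) auto

lemma conj_part_eq_zero: "sum_list lam < j \<Longrightarrow> conj_part lam j = 0"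
  unfolding conj_part_def by (force dest: elem_le_sum_list)

text \<open>The boxes of the diagram are counted by columns and by rows; no row is longer than
  \<open>sum_list lam\<close>, so the range of columns misses none.\<close>

lemma sum_conj_part: "(\<Sum>j=1..sum_list lam. conj_part lam j) = sum_list lam"
proof -
  let ?k = "sum_list lam" and ?s = "length lam"
  have "conj_part lam j = (\<Sum>i<?s. if j \<le> lam ! i then 1 else 0)" for j
    unfolding conj_part_def by (auto simp: sum.If_cases intro: arg_cong[where f = card])
  then have "(\<Sum>j=1..?k. conj_part lam j) = (\<Sum>i<?s. \<Sum>j=1..?k. if j \<le> lam ! i then 1 else 0)"
    by (simp only: sum.swap[of _ "{..<?s}"])
  also have "\<dots> = (\<Sum>i<?s. lam ! i)"
  proof (intro sum.cong refl)
    fix i assume "i \<in> {..<?s}"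
    then have "lam ! i \<le> ?k"
      by (simp add: elem_le_sum_list)
    then have "{1..?k} \<inter> {j. j \<le> lam ! i} = {1..lam ! i}"
      by auto
    then show "(\<Sum>j=1..?k. if j \<le> lam ! i then 1 else 0) = lam ! i"
      by (simp add: sum.If_cases)
  qed
  finally show ?thesis
    by (simp add: sum_list_sum_nth atLeast0LessThan)
qed

theorem theorem4p12:
  fixes n k s :: nat and lam :: "nat list" and f :: rat_mpoly
  assumes "0 < k" and "k \<le> n"
    and "partition_of lam k s"
    and "f \<in> V_space n lam" and "f \<noteq> 0"
  shows "map (Poly_Mapping.lookup (leading_monom f)) [1..<n + 1] \<in> C_seqs n lam"
proof -
  let ?F = "\<lambda>m. weight m * Poly_Mapping.lookup f m"
  have F: "?F u \<noteq> 0 \<longleftrightarrow> u \<in> Poly_Mapping.keys f" for u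
    by (simp add: weight_nonzero in_keys_iff)
  have k: "sum_list lam = k"
    using assms(3) by (simp add: partition_of_def)
  note gens = I_gens_in_annihilator[OF assms(4)]
  have "Poly_Mapping.keys f \<noteq> {}"
    using sum_singles[of f] assms(5) by force
  then have top: "leading_monom f \<in> Poly_Mapping.keys f"
    by (simp add: leading_monom_def)
  have "\<exists>z\<in>multi_shuffles (map (\<lambda>j. rev [0..<conj_part lam j]) [1..<sum_list lam + 1] @
      [replicate (n - (\<Sum>j=1..sum_list lam. conj_part lam j)) (length lam - 1)]).
    list_all2 (\<le>) (map (Poly_Mapping.lookup (leading_monom f)) [1..<1 + n]) z"
  proof (rule leading_exponents_le_shuffle[where F = ?F])
    show "(\<Sum>j=1..sum_list lam. conj_part lam j) \<le> n"
      using assms(2) k sum_conj_part[of lam] by linarith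
    show "?F (leading_monom f) \<noteq> 0"
      using top F by blast
    show "u \<le> leading_monom f" if "?F u \<noteq> 0" for u
      using that F by (simp add: leading_monom_def)
    show "Poly_Mapping.keys u \<subseteq> {1..<1 + n}" if "?F u \<noteq> 0" for u
    proof -
      have "Poly_Mapping.keys u \<subseteq> {1..n}"
        using that F assms(4) by (auto simp: V_space_def polys_def)
      then show ?thesis by auto
    qed
    show "var i ^ length lam \<in> annihilator ?F" if "i \<in> {1..<1 + n}" for i
      using that by (intro gens) (auto simp: I_gens_def)
    show "elem_sym d S \<in> annihilator ?F"
      if "S \<subseteq> {1..<1 + n}"
        "int d > int (card S) - (\<Sum>j=n - card S + 1..n. int (conj_part lam j))" for d S
      using that by (intro gens) (auto simp: I_gens_def atLeastLessThanSuc_atLeastAtMost)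
  qed (auto intro: conj_part_antimono conj_part_eq_zero)
  from this[unfolded sum_conj_part] show ?thesis
    by (simp add: C_seqs_def del: upt_Suc)
qed

end
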